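(* Let $\mathbb{X}$ be a finite-dimensional Euclidean space, $\varphi:\mathbb{X}\to\mathbb{R}\cup\{\infty\}$ a proper lower semicontinuous convex function, and $(\bar x,\bar v)\in\mathrm{gph}\,\partial\varphi$. Then $$D\partial\varphi^*(\bar v|\bar x)(0)=\mathrm{Ker}\,D\partial\varphi(\bar x|\bar v)=\mathrm{Ker}\,d^2\varphi(\bar x|\bar v).$$ Consequently, if $\varphi$ satisfies the quadratic growth condition at $\bar x$ for $\bar v$, then $$\mathrm{Ker}\,d^2\varphi(\bar x|\bar v)=T_{\partial\varphi^*(\bar v)}(\bar x).$$
   Context: $\varphi^*$ is the Fenchel conjugate and $\partial$ the convex subdifferential. Tangent cone: $T_\Omega(\bar u):=\{w\mid\exists\,t_k\downarrow0,\ w_k\to w,\ \bar u+t_kw_k\in\Omega\}$ for $\bar u\in\Omega$. Graphical derivative: for a set-valued mapping $F$ and $(\bar x,\bar y)\in\mathrm{gph}\,F$, $DF(\bar x|\bar y)(w):=\{z\mid(w,z)\in T_{\mathrm{gph}\,F}(\bar x,\bar y)\}$. The kernel of a set-valued mapping $G$ is $\mathrm{Ker}\,G=\{w\mid0\in G(w)\}$. Second subderivative: $d^2\varphi(\bar x|\bar v)(w):=\liminf_{w'\to w,\ t\downarrow0}\dfrac{\varphi(\bar x+tw')-\varphi(\bar x)-t\langle\bar v,w'\rangle}{\frac12t^2}$, and $\mathrm{Ker}\,d^2\varphi(\bar x|\bar v)=\{w\mid d^2\varphi(\bar x|\bar v)(w)=0\}$. Quadratic growth condition: $\varphi$ satisfies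 it at $\bar x\in\mathrm{dom}\,\varphi$ for $\bar v\in\partial\varphi(\bar x)$ if there exist $c,\varepsilon>0$ such that $\varphi(x)\ge\varphi(\bar x)+\langle\bar v,x-\bar x\rangle+\frac c2[d(x;(\partial\varphi)^{-1}(\bar v))]^2$ for all $x$ with $\|x-\bar x\|<\varepsilon$, where $d(\cdot;\Omega)$ is the distance to $\Omega$. *)

theory Defs
  imports "HOL-Analysis.Analysis"
begin

text \<open>Functions with values in the reals extended by plus infinity are functions
  to \<^typ>\<open>ereal\<close> that never take the value minus infinity; properness includes this.\<close>

definition proper_fun :: "('a \<Rightarrow> ereal) \<Rightarrow> bool" where
  "proper_fun \<phi> \<longleftrightarrow> (\<forall>x. \<phi> x \<noteq> -\<infinity>) \<and> (\<exists>x. \<phi> x \<noteq> \<infinity>)"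

text \<open>The neighbourhood filter includes the centre \<open>x\<close> itself; for lower
  semicontinuity this is equivalent to the punctured version.\<close>

definition lsc_fun :: "('a::topological_space \<Rightarrow> ereal) \<Rightarrow> bool" where
  "lsc_fun \<phi> \<longleftrightarrow> (\<forall>x. \<phi> x \<le> Liminf (nhds x) \<phi>)"

definition epi :: "('a \<Rightarrow> ereal) \<Rightarrow> ('a \<times> real) set" where
  "epi \<phi> = {(x, r). \<phi> x \<le> ereal r}"

definition convex_fun :: "('a::real_vector \<Rightarrow> ereal) \<Rightarrow> bool" where
  "convex_fun \<phi> \<longleftrightarrow> convex (epi \<phi>)"

definition conjugate :: "('a::real_inner \<Rightarrow> ereal) \<Rightarrow> 'a \<Rightarrow> ereal" where
  "conjugate \<phi> v = (SUP x. ereal (v \<bullet> x) - \<phi> x)"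

text \<open>The subdifferential is empty at points where the function is not finite.\<close>

definition subdiff :: "('a::real_inner \<Rightarrow> ereal) \<Rightarrow> 'a \<Rightarrow> 'a set" where
  "subdiff \<phi> x = {v. \<bar>\<phi> x\<bar> \<noteq> \<infinity> \<and> (\<forall>y. \<phi> x + ereal (v \<bullet> (y - x)) \<le> \<phi> y)}"

definition gph :: "('a \<Rightarrow> 'b set) \<Rightarrow> ('a \<times> 'b) set" where
  "gph F = {(x, y). y \<in> F x}"

definition inv_map :: "('a \<Rightarrow> 'b set) \<Rightarrow> 'b \<Rightarrow> 'a set" where
  "inv_map F y = {x. y \<in> F x}"

definition Ker_map :: "('a \<Rightarrow> 'b::zero set) \<Rightarrow> 'a set" where
  "Ker_map G = {w. 0 \<in> G w}"

definition tangent_cone :: "'a::real_normed_vector set \<Rightarrow> 'a \<Rightarrow> 'a set" where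
  "tangent_cone \<Omega> u =
     {w. \<exists>(t :: nat \<Rightarrow> real) (ws :: nat \<Rightarrow> 'a).
           (\<forall>k. t k > 0) \<and> t \<longlonglongrightarrow> 0 \<and> ws \<longlonglongrightarrow> w \<and> (\<forall>k. u + t k *\<^sub>R ws k \<in> \<Omega>)}"

definition graphical_deriv ::
  "('a::real_normed_vector \<Rightarrow> 'b::real_normed_vector set) \<Rightarrow> 'a \<Rightarrow> 'b \<Rightarrow> 'a \<Rightarrow> 'b set" where
  "graphical_deriv F x y w = {z. (w, z) \<in> tangent_cone (gph F) (x, y)}"

text \<open>Here \<open>w' \<rightarrow> w\<close> allows \<open>w' = w\<close>, while \<open>t\<close> runs through positive reals only.\<close>

definition second_subderiv :: "('a::real_inner \<Rightarrow> ereal) \<Rightarrow> 'a \<Rightarrow> 'a \<Rightarrow> 'a \<Rightarrow> ereal" where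
  "second_subderiv \<phi> x v w =
     Liminf (nhds w \<times>\<^sub>F at_right (0::real))
       (\<lambda>(w', t). (\<phi> (x + t *\<^sub>R w') - \<phi> x - ereal (t * (v \<bullet> w'))) / ereal (1/2 * t\<^sup>2))"

definition Ker_fun :: "('a \<Rightarrow> ereal) \<Rightarrow> 'a set" where
  "Ker_fun f = {w. f w = 0}"

definition quadratic_growth :: "('a::real_inner \<Rightarrow> ereal) \<Rightarrow> 'a \<Rightarrow> 'a \<Rightarrow> bool" where
  "quadratic_growth \<phi> xbar v \<longleftrightarrow>
     (\<exists>c>0. \<exists>\<epsilon>>0. \<forall>x. norm (x - xbar) < \<epsilon> \<longrightarrow>
        \<phi> x \<ge> \<phi> xbar + ereal (v \<bullet> (x - xbar))
               + ereal (c/2 * (infdist x (inv_map (subdiff \<phi>) v))\<^sup>2))"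

end

theory Submission
  imports Defs
begin

text \<open>
  Write \<open>g y = \<phi> y - \<phi> xbar - vbar \<bullet> (y - xbar)\<close>. This gap is nonnegative and vanishes exactly on
  the points at which \<open>vbar\<close> is a subgradient, and a direction \<open>w\<close> lies in the kernel of the second
  subderivative iff \<open>g\<close> is of order \<open>o(t\<^sup>2)\<close> along some points \<open>xbar + t w'\<close> with \<open>w' \<rightarrow> w\<close> and
  \<open>t \<down> 0\<close> (\<open>Ker_second_subderiv_iff\<close>).

  The engine is Minty's theorem (\<open>subdiff_resolvent_exists\<close>): every \<open>z\<close> splits as \<open>z = p + u\<close> with
  \<open>u\<close> a subgradient at \<open>p\<close>. It is used twice.

  \<^item> Subgradients of the conjugate are the inverse of the subgradients of \<open>\<phi>\<close>. If \<open>x\<close> is a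
    subgradient of the conjugate at \<open>v\<close>, split \<open>x + v = p + u\<close>; then \<open>v - u = p - x\<close>, and
    monotonicity of the subdifferential of the conjugate forces \<open>p = x\<close>. The
    first equality is then just the exchange of the two coordinates of the graph.

  \<^item> A point \<open>x\<close> with a small gap is close to a point that has a subgradient close to \<open>vbar\<close>: split
    \<open>x + vbar = p + u\<close>; then \<open>u - vbar = x - p\<close>, and the subgradient inequality at \<open>p\<close>, with
    \<open>g p \<ge> 0\<close>, gives \<open>\<parallel>x - p\<parallel>\<^sup>2 \<le> g x\<close>. Thus if \<open>g x = o(t\<^sup>2)\<close>, both errors are \<open>o(t)\<close>, so
    \<open>(w, 0)\<close> is tangent to the graph. The converse inclusion is the subgradient inequality at the
    nearby points, tested at \<open>xbar\<close>.

  Under quadratic growth the distance from \<open>x\<close> to the set of zeros of \<open>g\<close> is \<open>O(sqrt (g x)) = o(t)\<close>,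
  so the points that witness membership in the kernel can be moved into that set without changing
  the limit direction.
\<close>

section \<open>Subgradients and Minty's theorem\<close>

lemma closed_epi:
  fixes \<phi> :: "'a::metric_space \<Rightarrow> ereal"
  assumes "lsc_fun \<phi>"
  shows "closed (epi \<phi>)"
  unfolding closed_sequential_limits
proof (intro allI impI)
  fix s :: "nat \<Rightarrow> 'a \<times> real" and l
  assume s: "(\<forall>n. s n \<in> epi \<phi>) \<and> s \<longlonglongrightarrow> l"
  obtain x r where l: "l = (x, r)" by fastforce
  have s1: "(\<lambda>n. fst (s n)) \<longlonglongrightarrow> x" and s2: "(\<lambda>n. snd (s n)) \<longlonglongrightarrow> r"
    using s l tendsto_fst[of s l] tendsto_snd[of s l] by auto
  have le: "\<phi> (fst (s n)) \<le> ereal (snd (s n))" for n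
    using s by (auto simp: epi_def split: prod.splits)
  have "\<phi> x \<le> ereal r"
  proof (rule ccontr)
    assume "\<not> \<phi> x \<le> ereal r"
    then obtain q where q: "ereal r < ereal q" "ereal q < \<phi> x"
      using ereal_dense2[of "ereal r" "\<phi> x"] by (auto simp: not_le)
    have "\<forall>\<^sub>F y in nhds x. ereal q < \<phi> y"
      using assms q(2) unfolding lsc_fun_def le_Liminf_iff by blast
    then have "\<forall>\<^sub>F n in sequentially. ereal q < \<phi> (fst (s n))"
      using s1 by (auto simp: filterlim_iff)
    moreover have "\<forall>\<^sub>F n in sequentially. snd (s n) < q"
      using order_tendstoD(2)[OF s2] q(1) by simp
    ultimately have "\<forall>\<^sub>F n in sequentially. False"
    proof eventually_elim
      case (elim n)
      then have "ereal q < ereal (snd (s n))" using le[of n] by (rule_tac less_le_trans)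
      then show ?case using elim by simp
    qed
    then show False by simp
  qed
  then show "l \<in> epi \<phi>" by (simp add: l epi_def)
qed

lemma subdiffE:
  assumes "v \<in> subdiff \<phi> x"
  obtains a where "\<phi> x = ereal a" and "\<And>y. ereal (a + v \<bullet> (y - x)) \<le> \<phi> y"
proof -
  obtain a where a: "\<phi> x = ereal a"
    using assms by (cases "\<phi> x") (auto simp: subdiff_def)
  with assms show thesis by (intro that[of a]) (auto simp: subdiff_def)
qed

lemma subdiff_monotone:
  assumes "u \<in> subdiff \<phi> p" "v \<in> subdiff \<phi> x"
  shows "0 \<le> (u - v) \<bullet> (p - x)"
proof -
  obtain a where a: "\<phi> p = ereal a" "\<And>y. ereal (a + u \<bullet> (y - p)) \<le> \<phi> y"
    using assms(1) by (elim subdiffE) blast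
  obtain b where b: "\<phi> x = ereal b" "\<And>y. ereal (b + v \<bullet> (y - x)) \<le> \<phi> y"
    using assms(2) by (elim subdiffE) blast
  have "a + u \<bullet> (x - p) \<le> b" "b + v \<bullet> (p - x) \<le> a"
    using a(1) a(2)[of x] b(1) b(2)[of p] by auto
  then show ?thesis by (simp add: inner_diff algebra_simps)
qed

text \<open>The point \<open>p\<close> is the proximal point of \<open>z\<close>: it minimises \<open>\<phi> y + \<parallel>y - z\<parallel>\<^sup>2 / 2\<close>. Minimising the
  continuous real function \<open>r + \<parallel>y - z\<parallel>\<^sup>2 / 2\<close> over the closed epigraph instead makes the usual
  compactness argument available; an affine minorant of \<open>\<phi>\<close>, which any subgradient provides, bounds
  the sublevel sets.\<close>

lemma subdiff_resolvent_exists: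
  fixes \<phi> :: "'a::euclidean_space \<Rightarrow> ereal"
  assumes proper: "proper_fun \<phi>" and lsc: "lsc_fun \<phi>" and conv: "convex_fun \<phi>"
    and v: "v \<in> subdiff \<phi> x"
  obtains p where "z - p \<in> subdiff \<phi> p"
proof -
  obtain a where a: "\<phi> x = ereal a" and minorant: "\<And>y. ereal (a + v \<bullet> (y - x)) \<le> \<phi> y"
    using v by (elim subdiffE) blast
  define h where "h = (\<lambda>(y, r). r + (norm (y - z))\<^sup>2 / 2)"
  define C where "C = h (x, a)"
  define K where "K = epi \<phi> \<inter> {q. h q \<le> C}"
  have cont: "continuous_on A h" for A
    unfolding h_def case_prod_unfold by (intro continuous_intros) auto
  have "closed K"
    unfolding K_def by (intro closed_Int closed_epi lsc closed_Collect_le cont continuous_on_const)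
  \<comment> \<open>Completing the square in \<open>a + v \<bullet> (y - x) + \<parallel>y - z\<parallel>\<^sup>2 / 2 \<le> C\<close> confines \<open>y\<close> to a ball around
    \<open>z - v\<close>.\<close>
  define R where "R = sqrt (2 * \<bar>C - a + v \<bullet> x - v \<bullet> z\<bar> + (norm v)\<^sup>2)"
  define B where "B = norm (z - v) + R"
  have bound: "norm y \<le> B \<and> \<bar>r\<bar> \<le> \<bar>C\<bar> + \<bar>a - v \<bullet> x\<bar> + norm v * B" if "(y, r) \<in> K" for y r
  proof -
    have "\<phi> y \<le> ereal r" and hC: "r + (norm (y - z))\<^sup>2 / 2 \<le> C"
      using that by (auto simp: K_def epi_def h_def)
    have "ereal (a + v \<bullet> (y - x)) \<le> ereal r"
      using minorant[of y] \<open>\<phi> y \<le> ereal r\<close> by (rule order_trans)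
    then have r: "a + v \<bullet> (y - x) \<le> r" by simp
    have "(norm (y - (z - v)))\<^sup>2 = (norm (y - z))\<^sup>2 + 2 * (v \<bullet> (y - z)) + (norm v)\<^sup>2"
      by (simp add: power2_norm_eq_inner inner_diff inner_commute algebra_simps)
    also have "\<dots> \<le> 2 * (C - a + v \<bullet> x - v \<bullet> z) + (norm v)\<^sup>2"
      using r hC by (simp add: inner_diff_right field_simps)
    also have "\<dots> \<le> 2 * \<bar>C - a + v \<bullet> x - v \<bullet> z\<bar> + (norm v)\<^sup>2"
      by (intro add_right_mono mult_left_mono abs_ge_self) simp
    finally have "norm (y - (z - v)) \<le> R"
      unfolding R_def by (intro real_le_rsqrt)
    then have y: "norm y \<le> B"
      unfolding B_def using norm_triangle_sub[of y "z - v"] by linarith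
    have "\<bar>v \<bullet> y\<bar> \<le> norm v * B"
      using Cauchy_Schwarz_ineq2[of v y] mult_left_mono[OF y norm_ge_zero[of v]] by linarith
    moreover have "r \<le> C" using hC zero_le_power2[of "norm (y - z)"] by argo
    moreover have "(a - v \<bullet> x) + v \<bullet> y \<le> r" using r by (simp add: inner_diff_right)
    ultimately have "\<bar>r\<bar> \<le> \<bar>C\<bar> + \<bar>a - v \<bullet> x\<bar> + norm v * B" by linarith
    with y show ?thesis by blast
  qed
  have "K \<subseteq> cball 0 B \<times> cball 0 (\<bar>C\<bar> + \<bar>a - v \<bullet> x\<bar> + norm v * B)"
    using bound by (auto simp: dist_norm)
  then have "bounded K"
    by (rule bounded_subset[rotated]) (intro bounded_Times bounded_cball)
  with \<open>closed K\<close> have "compact K" by (simp add: compact_eq_bounded_closed)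
  moreover have "(x, a) \<in> K" by (simp add: K_def C_def epi_def a)
  ultimately have "\<exists>q\<in>K. \<forall>q'\<in>K. h q \<le> h q'"
    by (intro continuous_attains_inf cont) auto
  then obtain q where q: "q \<in> K" "\<And>q'. q' \<in> K \<Longrightarrow> h q \<le> h q'" by auto
  obtain p r where pr: "q = (p, r)" by fastforce
  have epi_q: "q \<in> epi \<phi>" and "h q \<le> C" using q(1) by (auto simp: K_def)
  have min: "h q \<le> h q'" if "q' \<in> epi \<phi>" for q'
    using q(2)[of q'] \<open>h q \<le> C\<close> that by (cases "h q' \<le> C") (auto simp: K_def)
  \<comment> \<open>Moving from the minimiser towards another point of the epigraph does not decrease \<open>h\<close>; the
    claim says that the derivative of \<open>h\<close> in that direction is nonnegative.\<close>
  have ineq: "r + (z - p) \<bullet> (y - p) \<le> s" if "(y, s) \<in> epi \<phi>" for y s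
  proof -
    define D where "D = s - r - (z - p) \<bullet> (y - p)"
    have quot: "0 \<le> D + c / 2 * (norm (y - p))\<^sup>2" if c: "0 < c" "c \<le> 1" for c
    proof -
      have "(1 - c) *\<^sub>R q + c *\<^sub>R (y, s) \<in> epi \<phi>"
        using conv epi_q \<open>(y, s) \<in> epi \<phi>\<close> c unfolding convex_fun_def convex_alt
        by (simp del: scaleR_Pair)
      from min[OF this] have le: "h q \<le> h ((1 - c) *\<^sub>R q + c *\<^sub>R (y, s))" .
      have shift: "(1 - c) *\<^sub>R p + c *\<^sub>R y - z = (p - z) + c *\<^sub>R (y - p)"
        by (simp add: algebra_simps)
      have expand: "(norm ((1 - c) *\<^sub>R p + c *\<^sub>R y - z))\<^sup>2
          = (norm (p - z))\<^sup>2 - 2 * c * ((z - p) \<bullet> (y - p)) + c\<^sup>2 * (norm (y - p))\<^sup>2"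
        unfolding shift power2_norm_eq_inner
        by (simp add: inner_add inner_diff inner_commute power2_eq_square algebra_simps)
      have "r + (norm (p - z))\<^sup>2 / 2 \<le> (1 - c) * r + c * s
          + ((norm (p - z))\<^sup>2 - 2 * c * ((z - p) \<bullet> (y - p)) + c\<^sup>2 * (norm (y - p))\<^sup>2) / 2"
        using le by (simp add: h_def pr expand)
      then have "0 \<le> c * (D + c / 2 * (norm (y - p))\<^sup>2)"
        by (simp add: D_def field_simps power2_eq_square)
      then show ?thesis using c by (simp add: zero_le_mult_iff)
    qed
    have "((\<lambda>c. D + c / 2 * (norm (y - p))\<^sup>2) \<longlongrightarrow> D + 0 / 2 * (norm (y - p))\<^sup>2) (at_right 0)"
      by (intro tendsto_intros) auto
    moreover have "\<forall>\<^sub>F c in at_right (0::real). 0 \<le> D + c / 2 * (norm (y - p))\<^sup>2"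
      using eventually_at_right_real[OF zero_less_one]
      by (rule eventually_mono) (use quot in auto)
    ultimately have "0 \<le> D + 0 / 2 * (norm (y - p))\<^sup>2"
      by (intro tendsto_lowerbound) auto
    then show ?thesis by (simp add: D_def)
  qed
  have "\<phi> p \<le> ereal r" using epi_q by (simp add: pr epi_def)
  then obtain b where b: "\<phi> p = ereal b" "b \<le> r"
    using proper by (cases "\<phi> p") (auto simp: proper_fun_def)
  have "r = b" using ineq[of p b] b by (simp add: epi_def)
  have "\<phi> p + ereal ((z - p) \<bullet> (y - p)) \<le> \<phi> y" for y
  proof (cases "\<phi> y")
    case (real s)
    then show ?thesis using ineq[of y s] b \<open>r = b\<close> by (simp add: epi_def)
  qed (use proper in \<open>auto simp: proper_fun_def\<close>)
  then show thesis by (intro that[of p]) (simp add: subdiff_def b)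
qed

section \<open>The conjugate inverts the subdifferential\<close>

lemma subdiff_conjugateI:
  assumes "v \<in> subdiff \<phi> x"
  shows "x \<in> subdiff (conjugate \<phi>) v"
proof -
  obtain a where a: "\<phi> x = ereal a" and sub: "\<And>y. ereal (a + v \<bullet> (y - x)) \<le> \<phi> y"
    using assms by (elim subdiffE) blast
  have lower: "ereal (u \<bullet> x - a) \<le> conjugate \<phi> u" for u
    unfolding conjugate_def by (rule SUP_upper2[of x]) (simp_all add: a)
  have "conjugate \<phi> v \<le> ereal (v \<bullet> x - a)"
    unfolding conjugate_def
  proof (rule SUP_least)
    fix y
    show "ereal (v \<bullet> y) - \<phi> y \<le> ereal (v \<bullet> x - a)"
      using sub[of y] by (cases "\<phi> y") (auto simp: inner_diff_right)
  qed
  then have v: "conjugate \<phi> v = ereal (v \<bullet> x - a)" using lower by (rule antisym)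
  have "ereal (v \<bullet> x - a) + ereal (x \<bullet> (u - v)) \<le> conjugate \<phi> u" for u
    using lower[of u] by (simp add: inner_diff inner_commute)
  then show ?thesis by (simp add: subdiff_def v)
qed

text \<open>For \<open>x \<in> subdiff (conjugate \<phi>) v\<close>, Minty's theorem produces some pair \<open>(p, u)\<close> in the graph of
  \<open>subdiff \<phi>\<close> with \<open>p + u = x + v\<close>. The easy inclusion puts \<open>(u, p)\<close> into the graph of
  \<open>subdiff (conjugate \<phi>)\<close>, and monotonicity of the latter identifies it with \<open>(v, x)\<close>.\<close>

lemma subdiff_conjugate_eq_inv_map:
  fixes \<phi> :: "'a::euclidean_space \<Rightarrow> ereal"
  assumes "proper_fun \<phi>" "lsc_fun \<phi>" "convex_fun \<phi>" "v\<^sub>0 \<in> subdiff \<phi> x\<^sub>0"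
  shows "subdiff (conjugate \<phi>) = inv_map (subdiff \<phi>)"
proof (intro ext set_eqI iffI)
  fix v x
  assume "x \<in> inv_map (subdiff \<phi>) v"
  then show "x \<in> subdiff (conjugate \<phi>) v" by (simp add: inv_map_def subdiff_conjugateI)
next
  fix v x
  assume x: "x \<in> subdiff (conjugate \<phi>) v"
  obtain p where p: "(x + v) - p \<in> subdiff \<phi> p"
    using subdiff_resolvent_exists[OF assms] .
  have "0 \<le> (p - x) \<bullet> ((x + v - p) - v)"
    by (rule subdiff_monotone[OF subdiff_conjugateI[OF p] x])
  also have "\<dots> = - (norm (p - x))\<^sup>2"
    by (simp add: power2_norm_eq_inner inner_diff algebra_simps)
  finally have "p = x" by simp
  with p show "x \<in> inv_map (subdiff \<phi>) v" by (simp add: inv_map_def)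
qed

section \<open>Tangent directions of graphs\<close>

lemma tangent_coneI:
  assumes "\<And>k. 0 < t k" "t \<longlonglongrightarrow> 0" "ws \<longlonglongrightarrow> w" "\<And>k. u + t k *\<^sub>R ws k \<in> \<Omega>"
  shows "w \<in> tangent_cone \<Omega> u"
  using assms unfolding tangent_cone_def by blast

lemma graphical_derivI:
  assumes "\<And>k. 0 < t k" "t \<longlonglongrightarrow> 0" "ws \<longlonglongrightarrow> w" "zs \<longlonglongrightarrow> z"
    and "\<And>k. y + t k *\<^sub>R zs k \<in> F (x + t k *\<^sub>R ws k)"
  shows "z \<in> graphical_deriv F x y w"
  unfolding graphical_deriv_def mem_Collect_eq
  by (rule tangent_coneI[OF assms(1,2) tendsto_Pair[OF assms(3,4)]])
    (simp add: gph_def assms(5))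

lemma graphical_derivE:
  assumes "z \<in> graphical_deriv F x y w"
  obtains t ws zs where "\<And>k. 0 < t k" "t \<longlonglongrightarrow> 0" "ws \<longlonglongrightarrow> w" "zs \<longlonglongrightarrow> z"
    and "\<And>k. y + t k *\<^sub>R zs k \<in> F (x + t k *\<^sub>R ws k)"
proof -
  obtain t ps where *: "\<And>k. 0 < t k" "t \<longlonglongrightarrow> 0" "ps \<longlonglongrightarrow> (w, z)"
    "\<And>k. (x, y) + t k *\<^sub>R ps k \<in> gph F"
    using assms unfolding graphical_deriv_def tangent_cone_def by blast
  show thesis
  proof (rule that[OF *(1,2)])
    show "(\<lambda>k. fst (ps k)) \<longlonglongrightarrow> w" "(\<lambda>k. snd (ps k)) \<longlonglongrightarrow> z"
      using tendsto_fst[OF *(3)] tendsto_snd[OF *(3)] by simp_all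
    show "y + t k *\<^sub>R snd (ps k) \<in> F (x + t k *\<^sub>R fst (ps k))" for k
      using *(4)[of k] by (cases "ps k") (simp add: gph_def)
  qed
qed

lemma graphical_deriv_inv_map:
  "z \<in> graphical_deriv (inv_map F) y x w \<longleftrightarrow> w \<in> graphical_deriv F x y z"
proof
  assume "z \<in> graphical_deriv (inv_map F) y x w"
  then show "w \<in> graphical_deriv F x y z"
    by (elim graphical_derivE, intro graphical_derivI) (auto simp: inv_map_def)
next
  assume "w \<in> graphical_deriv F x y z"
  then show "z \<in> graphical_deriv (inv_map F) y x w"
    by (elim graphical_derivE, intro graphical_derivI) (auto simp: inv_map_def)
qed

section \<open>The kernel of the second subderivative\<close>

text \<open>At a subgradient the second-order difference quotients are nonnegative, so their lower limit
  vanishes iff they tend to zero along some sequence. Clearing the denominator turns this into an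
  upper bound on \<open>\<phi>\<close> that is free of extended subtraction and division.\<close>

lemma Ker_second_subderiv_iff:
  fixes \<phi> :: "'a::real_inner \<Rightarrow> ereal"
  assumes v: "v \<in> subdiff \<phi> x"
  shows "w \<in> Ker_fun (second_subderiv \<phi> x v) \<longleftrightarrow>
    (\<exists>t ws e. (\<forall>k. 0 < t k) \<and> t \<longlonglongrightarrow> 0 \<and> ws \<longlonglongrightarrow> w \<and> e \<longlonglongrightarrow> 0 \<and>
      (\<forall>k. \<phi> (x + t k *\<^sub>R ws k) \<le> \<phi> x + ereal (t k * (v \<bullet> ws k) + e k * (t k)\<^sup>2)))"
    (is "_ \<longleftrightarrow> (\<exists>t ws e. ?P t ws e)")
proof -
  obtain a where a: "\<phi> x = ereal a" and sub: "\<And>y. ereal (a + v \<bullet> (y - x)) \<le> \<phi> y"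
    using v by (elim subdiffE) blast
  define Q where "Q = (\<lambda>(w', t). (\<phi> (x + t *\<^sub>R w') - \<phi> x - ereal (t * (v \<bullet> w'))) / ereal (1/2 * t\<^sup>2))"
  define F where "F = nhds w \<times>\<^sub>F at_right (0::real)"
  have d2: "second_subderiv \<phi> x v w = Liminf F Q"
    by (simp add: second_subderiv_def Q_def F_def)
  have Q_le: "Q (w', t) \<le> ereal (2 * e)
      \<longleftrightarrow> \<phi> (x + t *\<^sub>R w') \<le> \<phi> x + ereal (t * (v \<bullet> w') + e * t\<^sup>2)" if "0 < t" for w' t e
  proof (cases "\<phi> (x + t *\<^sub>R w')")
    case (real b)
    then show ?thesis
      using that by (simp add: Q_def a field_simps) linarith
  qed (use that sub[of "x + t *\<^sub>R w'"] in \<open>auto simp: Q_def a\<close>)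
  have Q_ge: "0 \<le> Q (w', t)" if "0 < t" for w' t
  proof (cases "\<phi> (x + t *\<^sub>R w')")
    case (real b)
    then show ?thesis
      using that sub[of "x + t *\<^sub>R w'"] by (simp add: Q_def a zero_ereal_def field_simps)
  qed (use that sub[of "x + t *\<^sub>R w'"] in \<open>auto simp: Q_def a\<close>)
  have pos: "\<forall>\<^sub>F q in F. 0 < snd q"
    unfolding F_def using eventually_prod2[of "nhds w" "\<lambda>t. 0 < t" "at_right (0::real)"]
    by (simp add: case_prod_unfold eventually_at_right_less)
  have "\<forall>\<^sub>F q in F. 0 \<le> Q q"
    using pos by eventually_elim (use Q_ge in auto)
  then have "0 \<le> Liminf F Q" by (rule Liminf_bounded)
  then have Ker: "w \<in> Ker_fun (second_subderiv \<phi> x v) \<longleftrightarrow> Liminf F Q \<le> 0"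
    by (auto simp: Ker_fun_def d2 intro: antisym)
  show ?thesis unfolding Ker
  proof
    assume L: "Liminf F Q \<le> 0"
    have "\<exists>q. dist (fst q) w < inverse (Suc k) \<and> 0 < snd q \<and> snd q < inverse (Suc k)
        \<and> Q q \<le> ereal (2 * inverse (Suc k))" for k
    proof (rule ccontr)
      let ?i = "inverse (real (Suc k))"
      assume none: "\<not> ?thesis"
      have "\<forall>\<^sub>F w' in nhds w. dist w' w < ?i"
        by (rule eventually_nhds_metric[THEN iffD2]) (rule exI[of _ ?i], simp)
      moreover have "\<forall>\<^sub>F t in at_right 0. 0 < t \<and> t < ?i"
        using eventually_at_right_real[of 0 ?i] by simp
      ultimately have "\<forall>\<^sub>F q in F. dist (fst q) w < ?i \<and> 0 < snd q \<and> snd q < ?i"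
        unfolding F_def by (auto simp: eventually_prod_filter)
      then have "\<forall>\<^sub>F q in F. ereal (2 * ?i) \<le> Q q"
        by eventually_elim (use none in \<open>force simp: not_le\<close>)
      then have "ereal (2 * ?i) \<le> Liminf F Q" by (rule Liminf_bounded)
      with L have "ereal (2 * ?i) \<le> 0" by (rule order_trans[rotated])
      then show False by (simp add: zero_ereal_def)
    qed
    then obtain q where q: "\<And>k. dist (fst (q k)) w < inverse (Suc k)" "\<And>k. 0 < snd (q k)"
      "\<And>k. snd (q k) < inverse (Suc k)" "\<And>k. Q (q k) \<le> ereal (2 * inverse (Suc k))"
      by metis
    have inv: "(\<lambda>k. inverse (real (Suc k))) \<longlonglongrightarrow> 0" by (rule LIMSEQ_inverse_real_of_nat)
    have "(\<lambda>k. snd (q k)) \<longlonglongrightarrow> 0"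
      by (rule tendsto_sandwich[OF _ _ tendsto_const inv];
          intro always_eventually allI less_imp_le q(2,3))
    moreover have "(\<lambda>k. dist (fst (q k)) w) \<longlonglongrightarrow> 0"
      by (rule tendsto_sandwich[OF _ _ tendsto_const inv];
          intro always_eventually allI zero_le_dist less_imp_le[OF q(1)])
    then have "(\<lambda>k. fst (q k)) \<longlonglongrightarrow> w" by (rule tendsto_dist_iff[THEN iffD2])
    moreover have "\<phi> (x + snd (q k) *\<^sub>R fst (q k))
        \<le> \<phi> x + ereal (snd (q k) * (v \<bullet> fst (q k)) + inverse (Suc k) * (snd (q k))\<^sup>2)" for k
      using q(4)[of k] Q_le[OF q(2), of "fst (q k)" k "inverse (Suc k)"] by simp
    ultimately have "?P (\<lambda>k. snd (q k)) (\<lambda>k. fst (q k)) (\<lambda>k. inverse (Suc k))"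
      using q(2) inv by blast
    then show "\<exists>t ws e. ?P t ws e" by (intro exI)
  next
    assume "\<exists>t ws e. ?P t ws e"
    then obtain t ws e where t: "\<And>k. 0 < t k" "t \<longlonglongrightarrow> 0" and ws: "ws \<longlonglongrightarrow> w" and e: "e \<longlonglongrightarrow> 0"
      and le: "\<And>k. \<phi> (x + t k *\<^sub>R ws k) \<le> \<phi> x + ereal (t k * (v \<bullet> ws k) + e k * (t k)\<^sup>2)"
      by blast
    have "filterlim t (at_right 0) sequentially"
      using t by (intro tendsto_imp_filterlim_at_right) auto
    then have lim: "filterlim (\<lambda>k. (ws k, t k)) F sequentially"
      unfolding F_def using ws by (intro filterlim_Pair)
    show "Liminf F Q \<le> 0"
    proof (rule ccontr)
      assume "\<not> Liminf F Q \<le> 0"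
      then obtain r where r: "0 < ereal r" "ereal r < Liminf F Q"
        using ereal_dense2[of 0 "Liminf F Q"] by (auto simp: not_le)
      then have "\<forall>\<^sub>F q in F. ereal r < Q q" by (intro less_LiminfD)
      then have "\<forall>\<^sub>F k in sequentially. ereal r < Q (ws k, t k)"
        using lim by (auto simp: filterlim_iff)
      moreover have "\<forall>\<^sub>F k in sequentially. e k < r / 2"
        using order_tendstoD(2)[OF e, of "r / 2"] r(1) by simp
      ultimately have "\<forall>\<^sub>F k in sequentially. False"
      proof eventually_elim
        case (elim k)
        have "Q (ws k, t k) \<le> ereal (2 * e k)" using le t(1) by (simp add: Q_le)
        with elim(1) have "ereal r < ereal (2 * e k)" by (rule less_le_trans)
        then show ?case using elim(2) by simp
      qed
      then show False by simp
    qed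
  qed
qed

text \<open>Nearby points with nearby subgradients have a gap of order \<open>o(t\<^sup>2)\<close>: the subgradient inequality,
  tested at the base point, bounds the gap by a product of two increments of order \<open>t\<close>, one of
  which is even \<open>o(t)\<close>.\<close>

lemma Ker_graphical_deriv_subset_Ker_second_subderiv:
  assumes v: "v \<in> subdiff \<phi> x"
  shows "Ker_map (graphical_deriv (subdiff \<phi>) x v) \<subseteq> Ker_fun (second_subderiv \<phi> x v)"
proof
  fix w
  assume "w \<in> Ker_map (graphical_deriv (subdiff \<phi>) x v)"
  then have "0 \<in> graphical_deriv (subdiff \<phi>) x v w" by (simp add: Ker_map_def)
  then obtain t ws zs where t: "\<And>k. 0 < t k" "t \<longlonglongrightarrow> 0" and ws: "ws \<longlonglongrightarrow> w" and zs: "zs \<longlonglongrightarrow> 0"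
    and z: "\<And>k. v + t k *\<^sub>R zs k \<in> subdiff \<phi> (x + t k *\<^sub>R ws k)"
    by (elim graphical_derivE) blast
  have "(\<lambda>k. zs k \<bullet> ws k) \<longlonglongrightarrow> 0"
    using tendsto_inner[OF zs ws] by simp
  moreover have "\<phi> (x + t k *\<^sub>R ws k) \<le> \<phi> x + ereal (t k * (v \<bullet> ws k) + (zs k \<bullet> ws k) * (t k)\<^sup>2)" for k
  proof -
    obtain a where a: "\<phi> (x + t k *\<^sub>R ws k) = ereal a"
      and sub: "\<And>y. ereal (a + (v + t k *\<^sub>R zs k) \<bullet> (y - (x + t k *\<^sub>R ws k))) \<le> \<phi> y"
      using z[of k] by (elim subdiffE) blast
    obtain b where "\<phi> x = ereal b" using v by (elim subdiffE) blast
    then show ?thesis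
      using sub[of x] by (simp add: a inner_add_left power2_eq_square algebra_simps)
  qed
  ultimately show "w \<in> Ker_fun (second_subderiv \<phi> x v)"
    unfolding Ker_second_subderiv_iff[OF v] using t ws by blast
qed

text \<open>The resolvent of \<open>y + v\<close> moves \<open>y\<close> and \<open>v\<close> by the same vector in opposite directions, and the
  square of its length is controlled by the gap at \<open>y\<close>. This plays the part of Ekeland's variational
  principle, with equal weights on the two errors.\<close>

lemma subgradient_near_small_gap:
  fixes \<phi> :: "'a::euclidean_space \<Rightarrow> ereal"
  assumes "proper_fun \<phi>" "lsc_fun \<phi>" "convex_fun \<phi>" and v: "v \<in> subdiff \<phi> x"
    and gap: "\<phi> y \<le> \<phi> x + ereal (v \<bullet> (y - x) + \<delta>)"
  obtains d where "v + d \<in> subdiff \<phi> (y - d)" "(norm d)\<^sup>2 \<le> \<delta>"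
proof -
  obtain p where p: "(y + v) - p \<in> subdiff \<phi> p"
    using subdiff_resolvent_exists[OF assms(1-4)] .
  define d where "d = y - p"
  have p': "v + d \<in> subdiff \<phi> (y - d)"
    using p by (simp add: d_def algebra_simps)
  obtain a where a: "\<phi> x = ereal a" and sub: "\<And>y. ereal (a + v \<bullet> (y - x)) \<le> \<phi> y"
    using v by (elim subdiffE) blast
  obtain b where b: "\<phi> (y - d) = ereal b"
    and sub': "\<And>u. ereal (b + (v + d) \<bullet> (u - (y - d))) \<le> \<phi> u"
    using p' by (elim subdiffE) blast
  have "ereal (b + (v + d) \<bullet> (y - (y - d))) \<le> ereal (a + (v \<bullet> (y - x) + \<delta>))"
    using order_trans[OF sub'[of y] gap] by (simp add: a)
  moreover have "a + v \<bullet> (y - d - x) \<le> b"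
    using sub[of "y - d"] by (simp add: b)
  ultimately have "(norm d)\<^sup>2 \<le> \<delta>"
    by (simp add: power2_norm_eq_inner inner_add_left inner_diff_right)
  with p' show thesis by (rule that)
qed

text \<open>A gap of \<open>o(t\<^sup>2)\<close> costs a displacement of \<open>o(t)\<close>, both in the point and in the subgradient.
  After division by \<open>t\<close> it vanishes in the limit, which leaves the tangent vector \<open>(w, 0)\<close>.\<close>

lemma Ker_second_subderiv_subset_Ker_graphical_deriv:
  fixes \<phi> :: "'a::euclidean_space \<Rightarrow> ereal"
  assumes "proper_fun \<phi>" "lsc_fun \<phi>" "convex_fun \<phi>" and v: "v \<in> subdiff \<phi> x"
  shows "Ker_fun (second_subderiv \<phi> x v) \<subseteq> Ker_map (graphical_deriv (subdiff \<phi>) x v)"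
proof
  fix w
  assume "w \<in> Ker_fun (second_subderiv \<phi> x v)"
  then obtain t ws e where t: "\<And>k. 0 < t k" "t \<longlonglongrightarrow> 0" and ws: "ws \<longlonglongrightarrow> w" and e: "e \<longlonglongrightarrow> 0"
    and le: "\<And>k. \<phi> (x + t k *\<^sub>R ws k) \<le> \<phi> x + ereal (t k * (v \<bullet> ws k) + e k * (t k)\<^sup>2)"
    unfolding Ker_second_subderiv_iff[OF v] by blast
  have "\<exists>d. v + d \<in> subdiff \<phi> (x + t k *\<^sub>R ws k - d) \<and> (norm d)\<^sup>2 \<le> e k * (t k)\<^sup>2" for k
  proof -
    have "\<phi> (x + t k *\<^sub>R ws k) \<le> \<phi> x + ereal (v \<bullet> (x + t k *\<^sub>R ws k - x) + e k * (t k)\<^sup>2)"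
      using le[of k] by simp
    from subgradient_near_small_gap[OF assms this] show ?thesis by blast
  qed
  then obtain d where d: "\<And>k. v + d k \<in> subdiff \<phi> (x + t k *\<^sub>R ws k - d k)"
    "\<And>k. (norm (d k))\<^sup>2 \<le> e k * (t k)\<^sup>2"
    by metis
  define zs where "zs k = d k /\<^sub>R t k" for k
  have d_eq: "d k = t k *\<^sub>R zs k" for k using t(1)[of k] by (simp add: zs_def)
  have zs: "zs \<longlonglongrightarrow> 0"
  proof (rule Lim_null_comparison)
    show "\<forall>\<^sub>F k in sequentially. norm (zs k) \<le> sqrt (e k)"
    proof (intro always_eventually allI real_le_rsqrt)
      show "(norm (zs k))\<^sup>2 \<le> e k" for k
        using d(2)[of k] t(1)[of k] by (simp add: d_eq power_mult_distrib mult.commute)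
    qed
    show "(\<lambda>k. sqrt (e k)) \<longlonglongrightarrow> 0" using tendsto_real_sqrt[OF e] by simp
  qed
  have "0 \<in> graphical_deriv (subdiff \<phi>) x v w"
  proof (rule graphical_derivI[OF t])
    show "(\<lambda>k. ws k - zs k) \<longlonglongrightarrow> w" using tendsto_diff[OF ws zs] by simp
    show "zs \<longlonglongrightarrow> 0" by (rule zs)
    show "v + t k *\<^sub>R zs k \<in> subdiff \<phi> (x + t k *\<^sub>R (ws k - zs k))" for k
      using d(1)[of k] by (simp add: d_eq algebra_simps)
  qed
  then show "w \<in> Ker_map (graphical_deriv (subdiff \<phi>) x v)" by (simp add: Ker_map_def)
qed

section \<open>Quadratic growth\<close>

lemma tangent_cone_inv_map_subset_Ker_graphical_deriv:
  "tangent_cone (inv_map F y) x \<subseteq> Ker_map (graphical_deriv F x y)"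
proof
  fix w
  assume "w \<in> tangent_cone (inv_map F y) x"
  then obtain t ws where "\<And>k. 0 < t k" "t \<longlonglongrightarrow> 0" "ws \<longlonglongrightarrow> w"
    "\<And>k. x + t k *\<^sub>R ws k \<in> inv_map F y"
    unfolding tangent_cone_def by blast
  then have "0 \<in> graphical_deriv F x y w"
    by (intro graphical_derivI[where zs = "\<lambda>_. 0"]) (auto simp: inv_map_def)
  then show "w \<in> Ker_map (graphical_deriv F x y)" by (simp add: Ker_map_def)
qed

text \<open>Growth bounds the squared distance to the set \<open>inv_map (subdiff \<phi>) v\<close> by a multiple of the gap,
  so points with a gap of \<open>o(t\<^sup>2)\<close> can be replaced by points of that set at the cost of \<open>o(t)\<close>.\<close>

lemma Ker_second_subderiv_subset_tangent_cone:
  fixes \<phi> :: "'a::real_inner \<Rightarrow> ereal"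
  assumes v: "v \<in> subdiff \<phi> x" and growth: "quadratic_growth \<phi> x v"
  shows "Ker_fun (second_subderiv \<phi> x v) \<subseteq> tangent_cone (inv_map (subdiff \<phi>) v) x"
proof
  fix w
  assume "w \<in> Ker_fun (second_subderiv \<phi> x v)"
  then obtain t ws e where t: "\<And>k. 0 < t k" "t \<longlonglongrightarrow> 0" and ws: "ws \<longlonglongrightarrow> w" and e: "e \<longlonglongrightarrow> 0"
    and le: "\<And>k. \<phi> (x + t k *\<^sub>R ws k) \<le> \<phi> x + ereal (t k * (v \<bullet> ws k) + e k * (t k)\<^sup>2)"
    unfolding Ker_second_subderiv_iff[OF v] by blast
  define S where "S = inv_map (subdiff \<phi>) v"
  have "S \<noteq> {}" using v by (auto simp: S_def inv_map_def)
  obtain c \<epsilon> where c: "0 < c" and \<epsilon>: "0 < \<epsilon>" and grow: "\<And>y. norm (y - x) < \<epsilon> \<Longrightarrow>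
      \<phi> x + ereal (v \<bullet> (y - x)) + ereal (c/2 * (infdist y S)\<^sup>2) \<le> \<phi> y"
    using growth unfolding quadratic_growth_def S_def by blast
  obtain a where a: "\<phi> x = ereal a" using v by (elim subdiffE) blast
  \<comment> \<open>The extra margin \<open>inverse (Suc k)\<close> allows near-minimisers of the distance instead of
    projections.\<close>
  have "\<exists>s\<in>S. dist (x + t k *\<^sub>R ws k) s < infdist (x + t k *\<^sub>R ws k) S + t k * inverse (Suc k)" for k
  proof -
    have "infdist (x + t k *\<^sub>R ws k) S < infdist (x + t k *\<^sub>R ws k) S + t k * inverse (Suc k)"
      using t(1)[of k] by simp
    then show ?thesis
      using \<open>S \<noteq> {}\<close> cInf_lessD[of "dist (x + t k *\<^sub>R ws k) ` S"
          "infdist (x + t k *\<^sub>R ws k) S + t k * inverse (Suc k)"]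
      by (auto simp: infdist_notempty)
  qed
  then obtain s where s: "\<And>k. s k \<in> S"
    "\<And>k. dist (x + t k *\<^sub>R ws k) (s k) < infdist (x + t k *\<^sub>R ws k) S + t k * inverse (Suc k)"
    by metis
  define us where "us k = (s k - x) /\<^sub>R t k" for k
  have s_eq: "s k = x + t k *\<^sub>R us k" for k using t(1)[of k] by (simp add: us_def)
  have "(\<lambda>k. t k *\<^sub>R ws k) \<longlonglongrightarrow> 0" using tendsto_scaleR[OF t(2) ws] by simp
  then have "(\<lambda>k. norm (t k *\<^sub>R ws k)) \<longlonglongrightarrow> 0" by (rule tendsto_norm_zero)
  then have near: "\<forall>\<^sub>F k in sequentially. norm (t k *\<^sub>R ws k) < \<epsilon>"
    using \<epsilon> by (rule order_tendstoD(2))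
  have "(\<lambda>k. ws k - us k) \<longlonglongrightarrow> 0"
  proof (rule Lim_null_comparison)
    show "\<forall>\<^sub>F k in sequentially. norm (ws k - us k) \<le> sqrt (2 / c * e k) + inverse (Suc k)"
      using near
    proof eventually_elim
      case (elim k)
      define D where "D = infdist (x + t k *\<^sub>R ws k) S / t k"
      have D: "infdist (x + t k *\<^sub>R ws k) S = t k * D" using t(1)[of k] by (simp add: D_def)
      have "\<phi> x + ereal (v \<bullet> (x + t k *\<^sub>R ws k - x)) + ereal (c/2 * (t k * D)\<^sup>2)
          \<le> \<phi> x + ereal (t k * (v \<bullet> ws k) + e k * (t k)\<^sup>2)"
        using order_trans[OF grow[of "x + t k *\<^sub>R ws k"] le[of k]] elim by (simp add: D)
      then have "(c/2 * D\<^sup>2) * (t k)\<^sup>2 \<le> e k * (t k)\<^sup>2"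
        by (simp add: a power_mult_distrib algebra_simps)
      then have "c/2 * D\<^sup>2 \<le> e k"
        using t(1)[of k] by simp
      then have "D\<^sup>2 \<le> 2 / c * e k"
        using c by (simp add: field_simps)
      then have "D \<le> sqrt (2 / c * e k)" by (rule real_le_rsqrt)
      moreover have "t k * norm (ws k - us k) < t k * (D + inverse (Suc k))"
        using s(2)[of k] t(1)[of k] unfolding D
        by (simp add: s_eq dist_norm distrib_left flip: scaleR_diff_right)
      then have "norm (ws k - us k) < D + inverse (Suc k)"
        using t(1)[of k] by (simp only: mult_less_cancel_left_pos)
      ultimately show ?case by linarith
    qed
    have "(\<lambda>k. 2 / c * e k) \<longlonglongrightarrow> 0" using tendsto_mult_right_zero[OF e] .
    then have "(\<lambda>k. sqrt (2 / c * e k)) \<longlonglongrightarrow> 0" using tendsto_real_sqrt by fastforce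
    then show "(\<lambda>k. sqrt (2 / c * e k) + inverse (Suc k)) \<longlonglongrightarrow> 0"
      using LIMSEQ_inverse_real_of_nat by (rule tendsto_add_zero)
  qed
  then have "(\<lambda>k. ws k - (ws k - us k)) \<longlonglongrightarrow> w - 0" by (intro tendsto_diff ws)
  then have "us \<longlonglongrightarrow> w" by simp
  then show "w \<in> tangent_cone (inv_map (subdiff \<phi>) v) x"
    using s(1) unfolding s_eq S_def by (intro tangent_coneI[OF t])
qed

theorem theorem3p3:
  fixes \<phi> :: "'a::euclidean_space \<Rightarrow> ereal" and xbar vbar :: 'a
  assumes "proper_fun \<phi>" and "lsc_fun \<phi>" and "convex_fun \<phi>"
    and "(xbar, vbar) \<in> gph (subdiff \<phi>)"
  shows "graphical_deriv (subdiff (conjugate \<phi>)) vbar xbar 0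
           = Ker_map (graphical_deriv (subdiff \<phi>) xbar vbar)
       \<and> Ker_map (graphical_deriv (subdiff \<phi>) xbar vbar)
           = Ker_fun (second_subderiv \<phi> xbar vbar)
       \<and> (quadratic_growth \<phi> xbar vbar \<longrightarrow>
           Ker_fun (second_subderiv \<phi> xbar vbar)
             = tangent_cone (subdiff (conjugate \<phi>) vbar) xbar)"
proof (intro conjI impI)
  have v: "vbar \<in> subdiff \<phi> xbar" using assms(4) by (simp add: gph_def)
  note inv = subdiff_conjugate_eq_inv_map[OF assms(1-3) v]
  show "graphical_deriv (subdiff (conjugate \<phi>)) vbar xbar 0
      = Ker_map (graphical_deriv (subdiff \<phi>) xbar vbar)"
    by (auto simp: inv Ker_map_def graphical_deriv_inv_map)
  show kernels: "Ker_map (graphical_deriv (subdiff \<phi>) xbar vbar)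
      = Ker_fun (second_subderiv \<phi> xbar vbar)"
    by (intro antisym Ker_graphical_deriv_subset_Ker_second_subderiv
        Ker_second_subderiv_subset_Ker_graphical_deriv assms(1-3) v)
  assume "quadratic_growth \<phi> xbar vbar"
  then show "Ker_fun (second_subderiv \<phi> xbar vbar)
      = tangent_cone (subdiff (conjugate \<phi>) vbar) xbar"
    using Ker_second_subderiv_subset_tangent_cone[OF v]
      tangent_cone_inv_map_subset_Ker_graphical_deriv[of "subdiff \<phi>" vbar xbar]
    unfolding inv kernels by blast
qed

end
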